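(* (Double infinite comb.) Let $\alpha_{i,n}\in(0,1)$ for $i\in\{1,2\}$ and $n\in\overline{\mathbb{N}}^*=\mathbb{N}^*\cup\{\infty\}$, and let $\Theta_i=\sum_{n\ge1}\prod_{k=1}^{n-1}(1-\alpha_{i,k})$. (i) Let $(X_n,M_n)_{n\in\mathbb{Z}}$ be a stationary Markov chain with values in $\{0,1\}\times\overline{\mathbb{N}}^*$ and the transition probabilities given in the context. Suppose $\Theta_1<\infty$ and $\Theta_2<\infty$. For $n\in\mathbb{N}$ define the left-infinite word $U_n=\ldots X_{n-2}X_{n-1}X_n$. Then $(U_n)_{n\ge0}$ is a stationary variable length Markov chain associated with the double infinite comb with, for $n\ge1$, $$q_{1^n0}(0)=\alpha_{2,n},\quad q_{1^\infty}(0)=\alpha_{2,\infty},\quad q_{0^n1}(1)=\alpha_{1,n},\quad q_{0^\infty}(1)=\alpha_{1,\infty},\qquad(\ast)$$ and with initial data $U_0=\ldots X_{-2}X_{-1}X_0$. (ii) Conversely, let $(U_n)_{n\ge0}$ be a stationary variable length Markov chain associated with the double infinite comb satisfying $(\ast)$. For $n\ge0$, let $X_n$ be the last letter of $U_n$ and define $$M_n=1+\sup\{0\le i\le n:\ X_{n-j}=X_n\ \text{ for all } j\in\{0,\ldots,i\}\}.$$ Then $(X_n,M_n)_{n\ge0}$ is a stationary Markov chain with the transition probabilities given in the context, where the $\alpha$'s are given by $(\ast)$, and with initial data $(X_0,M_0)$. This stationary Markov chain can be extended to the time set $\mathbb{Z}$ as usual.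
   Context: Letter/memory chain: with $a_1=0$, $a_2=1$, the transitions on $\{0,1\}\times\overline{\mathbb{N}}^*$ are: from $(a_i,n)$ with $n\in\mathbb{N}^*=\{1,2,\ldots\}$, go to $(a_i,n+1)$ with probability $1-\alpha_{i,n}$ and to $(a_j,1)$, $j\neq i$, with probability $\alpha_{i,n}$; from $(a_i,\infty)$, stay at $(a_i,\infty)$ with probability $1-\alpha_{i,\infty}$ and go to $(a_j,1)$, $j\ne i$, with probability $\alpha_{i,\infty}$. Variable length Markov chain (VLMC): let $\mathcal{L}=\{0,1\}^{-\mathbb{N}}$ be the set of left-infinite words. The double infinite comb is the context tree with set of leaves (contexts) $\mathcal{C}=\{0^n1:n\ge1\}\cup\{1^n0:n\ge1\}\cup\{0^\infty,1^\infty\}$, each context $c$ carrying a probability distribution $q_c$ on $\{0,1\}$. For $U\in\mathcal{L}$, its context $\mathrm{pref}(U)$ is the leaf obtained by reading $U$ from right to left: $\mathrm{pref}(\ldots10^n)=0^n1$, $\mathrm{pref}(\ldots01^n)=1^n0$ for $n\ge1$, $\mathrm{pref}(\ldots000)=0^\infty$, $\mathrm{pref}(\ldots111)=1^\infty$. The associated VLMC is the $\mathcal{L}$-valued Markov chain with transitions $\mathbb{P}(U_{n+1}=U_n\ell\mid U_n)=q_{\mathrm{pref}(U_n)}(\ell)$, $\ell\in\{0,1\}$.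
   Formalization: In (ii) the supremum defining M_n ranges over all i ≥ 0 (letters at negative times read from U_0) instead of 0 ≤ i ≤ n; with the printed bound M_0 = 1 always, and (X_n, M_n) is never stationary. *)

theory Defs
  imports "HOL-Probability.Probability"
begin

section \<open>Stationary processes and Markov chains\<close>

text \<open>
  The time type is \<^typ>\<open>nat\<close> or \<^typ>\<open>int\<close>, and the processes take values in a measurable
  space \<open>S\<close>, not necessarily discrete: the state space of a variable length Markov chain is
  uncountable.  All chains considered here have finitely supported transition probabilities, so
  a transition kernel is a function into \<^typ>\<open>'s pmf\<close>.
\<close>

definition past_algebra ::
  "'w measure \<Rightarrow> 's measure \<Rightarrow> ('t::linordered_semidom \<Rightarrow> 'w \<Rightarrow> 's) \<Rightarrow> 't \<Rightarrow> 'w measure" where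
  "past_algebra P S Z n = sigma (space P) {Z k -` A \<inter> space P | k A. k \<le> n \<and> A \<in> sets S}"

definition markov_chain ::
  "'w measure \<Rightarrow> 's measure \<Rightarrow> ('s \<Rightarrow> 's pmf) \<Rightarrow> ('t::linordered_semidom \<Rightarrow> 'w \<Rightarrow> 's) \<Rightarrow> bool" where
  "markov_chain P S K Z \<longleftrightarrow>
     prob_space P \<and>
     (\<forall>n. Z n \<in> measurable P S) \<and>
     (\<forall>n. \<forall>A\<in>sets S.
        AE \<omega> in P. real_cond_exp P (past_algebra P S Z n)
                     (indicat_real {\<omega> \<in> space P. Z (n + 1) \<omega> \<in> A}) \<omega>
                   = measure_pmf.prob (K (Z n \<omega>)) A)"

definition stationary_process ::
  "'w measure \<Rightarrow> 's measure \<Rightarrow> ('t::linordered_semidom \<Rightarrow> 'w \<Rightarrow> 's) \<Rightarrow> bool" where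
  "stationary_process P S Z \<longleftrightarrow>
     distr P (PiM UNIV (\<lambda>_. S)) (\<lambda>\<omega> n. Z (n + 1) \<omega>) =
     distr P (PiM UNIV (\<lambda>_. S)) (\<lambda>\<omega> n. Z n \<omega>)"

definition stationary_markov_chain ::
  "'w measure \<Rightarrow> 's measure \<Rightarrow> ('s \<Rightarrow> 's pmf) \<Rightarrow> ('t::linordered_semidom \<Rightarrow> 'w \<Rightarrow> 's) \<Rightarrow> bool" where
  "stationary_markov_chain P S K Z \<longleftrightarrow> markov_chain P S K Z \<and> stationary_process P S Z"

section \<open>The letter/memory chain\<close>

text \<open>
  The letters \<open>0\<close> and \<open>1\<close> are \<^const>\<open>False\<close> and \<^const>\<open>True\<close>; thus \<open>a\<^sub>1\<close> is \<^const>\<open>False\<close> and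
  \<open>a\<^sub>2\<close> is \<^const>\<open>True\<close>.
\<close>

definition letter_index :: "bool \<Rightarrow> nat" where
  "letter_index x = (if x then 2 else 1)"

definition letter_memory_space :: "(bool \<times> enat) measure" where
  "letter_memory_space = count_space (UNIV \<times> {1..})"

definition letter_memory_kernel ::
  "(nat \<Rightarrow> enat \<Rightarrow> real) \<Rightarrow> bool \<times> enat \<Rightarrow> (bool \<times> enat) pmf" where
  "letter_memory_kernel \<alpha> = (\<lambda>(x, n).
     map_pmf (\<lambda>switch. if switch then (\<not> x, 1)
                       else (x, case n of enat m \<Rightarrow> enat (m + 1) | \<infinity> \<Rightarrow> \<infinity>))
       (bernoulli_pmf (\<alpha> (letter_index x) n)))"

text \<open>The summand with index \<open>m\<close> is the one for \<open>n = m + 1\<close> in the sum over \<open>n \<ge> 1\<close>.\<close>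

definition Theta :: "(nat \<Rightarrow> enat \<Rightarrow> real) \<Rightarrow> nat \<Rightarrow> ennreal" where
  "Theta \<alpha> i = (\<Sum>m. ennreal (\<Prod>k=1..m. 1 - \<alpha> i (enat k)))"

section \<open>Variable length Markov chains\<close>

text \<open>
  A left-infinite word is indexed from right to left: \<open>u 0\<close> is its last letter.
\<close>

type_synonym left_word = "nat \<Rightarrow> bool"

definition left_word_space :: "left_word measure" where
  "left_word_space = PiM UNIV (\<lambda>_. count_space UNIV)"

definition append_letter :: "left_word \<Rightarrow> bool \<Rightarrow> left_word" where
  "append_letter u l = (\<lambda>k. case k of 0 \<Rightarrow> l | Suc j \<Rightarrow> u j)"

datatype ctxt = Finite_ctxt "bool list" | Infinite_ctxt "nat \<Rightarrow> bool"

fun reads_ctxt :: "left_word \<Rightarrow> ctxt \<Rightarrow> bool" where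
  "reads_ctxt u (Finite_ctxt w) \<longleftrightarrow> (\<forall>k < length w. u k = w ! k)"
| "reads_ctxt u (Infinite_ctxt v) \<longleftrightarrow> u = v"

definition pref :: "ctxt set \<Rightarrow> left_word \<Rightarrow> ctxt" where
  "pref C u = (THE c. c \<in> C \<and> reads_ctxt u c)"

definition vlmc_kernel :: "ctxt set \<Rightarrow> (ctxt \<Rightarrow> bool pmf) \<Rightarrow> left_word \<Rightarrow> left_word pmf" where
  "vlmc_kernel C q u = map_pmf (append_letter u) (q (pref C u))"

definition stationary_vlmc ::
  "'w measure \<Rightarrow> ctxt set \<Rightarrow> (ctxt \<Rightarrow> bool pmf) \<Rightarrow> (nat \<Rightarrow> 'w \<Rightarrow> left_word) \<Rightarrow> bool" where
  "stationary_vlmc P C q U \<longleftrightarrow> stationary_markov_chain P left_word_space (vlmc_kernel C q) U"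

text \<open>\<open>run_ctxt x n\<close> is \<open>0\<^sup>n1\<close> if \<open>x\<close> is \<open>0\<close>, and \<open>1\<^sup>n0\<close> if \<open>x\<close> is \<open>1\<close>.\<close>

definition run_ctxt :: "bool \<Rightarrow> nat \<Rightarrow> ctxt" where
  "run_ctxt x n = Finite_ctxt (replicate n x @ [\<not> x])"

definition const_ctxt :: "bool \<Rightarrow> ctxt" where
  "const_ctxt x = Infinite_ctxt (\<lambda>_. x)"

definition double_comb :: "ctxt set" where
  "double_comb =
     {run_ctxt False n | n. n \<ge> 1} \<union> {run_ctxt True n | n. n \<ge> 1} \<union>
     {const_ctxt False, const_ctxt True}"

definition comb_probabilities :: "(nat \<Rightarrow> enat \<Rightarrow> real) \<Rightarrow> (ctxt \<Rightarrow> bool pmf) \<Rightarrow> bool" where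
  "comb_probabilities \<alpha> q \<longleftrightarrow>
     (\<forall>n\<ge>1. pmf (q (run_ctxt True n)) False = \<alpha> 2 (enat n)) \<and>
     pmf (q (const_ctxt True)) False = \<alpha> 2 \<infinity> \<and>
     (\<forall>n\<ge>1. pmf (q (run_ctxt False n)) True = \<alpha> 1 (enat n)) \<and>
     pmf (q (const_ctxt False)) True = \<alpha> 1 \<infinity>"

section \<open>Passing between the two processes\<close>

definition word_process :: "(int \<Rightarrow> 'w \<Rightarrow> bool) \<Rightarrow> nat \<Rightarrow> 'w \<Rightarrow> left_word" where
  "word_process X n \<omega> = (\<lambda>k. X (int n - int k) \<omega>)"

text \<open>
  The letter at time \<open>n \<ge> 0\<close> is the last letter of \<open>U\<^sub>n\<close>; the letters at negative times are
  those of the initial word \<open>U\<^sub>0 = \<dots>X\<^sub>-\<^sub>2X\<^sub>-\<^sub>1X\<^sub>0\<close>.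
\<close>

definition letter :: "(nat \<Rightarrow> 'w \<Rightarrow> left_word) \<Rightarrow> int \<Rightarrow> 'w \<Rightarrow> bool" where
  "letter U n \<omega> = (if n \<ge> 0 then U (nat n) \<omega> 0 else U 0 \<omega> (nat (- n)))"

text \<open>
  The supremum ranges over all \<open>i \<ge> 0\<close> and so looks into the initial word; the run may be
  infinite.  With the restriction \<open>i \<le> n\<close>, one would have \<open>M\<^sub>0 = 1\<close> identically, and
  \<open>(X\<^sub>n, M\<^sub>n)\<close> would not be stationary: stationarity would force \<open>M\<^sub>1 = 1\<close> almost surely,
  while letters are repeated with positive probability.
\<close>

definition memory :: "(nat \<Rightarrow> 'w \<Rightarrow> left_word) \<Rightarrow> nat \<Rightarrow> 'w \<Rightarrow> enat" where
  "memory U n \<omega> =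
     1 + (SUP i \<in> {i. \<forall>j\<le>i. letter U (int n - int j) \<omega> = letter U (int n) \<omega>}. enat i)"

end

theory Submission
  imports Defs
begin

text \<open>
  A word over two letters determines the state consisting of its last letter and the length of
  its final run, which may be infinite. Two facts about this map \<open>run_state\<close> carry the proof.
  The context of a word in the double comb is a relabelling of its state
  (\<open>pref_double_comb\<close>), so the law of the next letter depends on the state only. And
  appending a letter to the word moves the state as in the letter/memory chain
  (\<open>run_state_append_letter\<close>). Hence the VLMC kernel projects onto the letter/memory
  kernel (\<open>map_run_state_vlmc_kernel\<close>). This concerns the kernels; the work lies in
  passing to the processes, whose pasts differ and which satisfy their path relations only almost
  surely.

  For the first half, the letters must be shown to determine the memories. Almost surely every
  transition increases the memory by one, with \<open>\<infinity> + 1 = \<infinity>\<close>, or switches the letter and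
  resets the memory to \<open>1\<close>. Running this recursion back along the infinite past shows that
  the memory is the length of the final run (\<open>memory_eq_run_length_AE\<close>). The transition
  probabilities given the past of the chain are therefore functions of the current word, and so
  they are also the transition probabilities given the past of the words, which is a smaller
  \<open>\<sigma>\<close>-algebra (\<open>stationary_vlmc_word_process\<close>).

  For the converse, the words of the VLMC almost surely extend one another, so they are the pasts
  of one two-sided letter sequence, the letters at negative times being those of the initial word.
  This sequence is stationary (\<open>stationary_letters\<close>), and the states of its pasts form a
  process on two-sided time. At time \<open>0\<close> its Markov property is the projection of that of the
  VLMC, and stationarity carries it to all times (\<open>markov_at_all_times\<close>). Restricting time
  gives the one-sided chain, and the law of the two-sided process is the required extension.

  The Markov property is handled in the integral form \<open>markov_at\<close>, at one time and over
  events of the past.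
\<close>

section \<open>The Markov property as an integral identity\<close>

definition measurable_kernel :: "'s measure \<Rightarrow> ('s \<Rightarrow> 's pmf) \<Rightarrow> bool" where
  "measurable_kernel S K \<longleftrightarrow>
     (\<forall>A\<in>sets S. (\<lambda>x. measure_pmf.prob (K x) A) \<in> borel_measurable S)"

text \<open>
  The defining property of a conditional expectation, for the transition between the times
  \<open>n\<close> and \<open>n + 1\<close> only. Written with integrals over events of the past, it can be
  transported along maps and restricted to smaller pasts.
\<close>

definition markov_at ::
  "'w measure \<Rightarrow> 's measure \<Rightarrow> ('s \<Rightarrow> 's pmf) \<Rightarrow> ('t::linordered_semidom \<Rightarrow> 'w \<Rightarrow> 's) \<Rightarrow> 't \<Rightarrow> bool"
  where
  "markov_at P S K Z n \<longleftrightarrow>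
     (\<forall>A\<in>sets S. \<forall>B\<in>sets (past_algebra P S Z n).
        measure P ({\<omega> \<in> space P. Z (n + 1) \<omega> \<in> A} \<inter> B) =
        (\<integral>\<omega>. indicat_real B \<omega> * measure_pmf.prob (K (Z n \<omega>)) A \<partial>P))"

lemma space_past_algebra [simp]: "space (past_algebra P S Z n) = space P"
  unfolding past_algebra_def by (rule space_measure_of) auto

lemma sets_past_algebra:
  "sets (past_algebra P S Z n) =
   sigma_sets (space P) {Z k -` A \<inter> space P | k A. k \<le> n \<and> A \<in> sets S}"
  unfolding past_algebra_def by (rule sets_measure_of) auto

lemma measurable_past_algebra:
  assumes "Z k \<in> space P \<rightarrow> space S" "k \<le> n"
  shows "Z k \<in> measurable (past_algebra P S Z n) S"
  using assms by (auto simp: measurable_def sets_past_algebra)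

lemma past_algebra_subset_sets:
  assumes "space P = space F"
    and "\<And>k. k \<le> n \<Longrightarrow> Z k \<in> measurable F S"
  shows "sets (past_algebra P S Z n) \<subseteq> sets F"
proof -
  have "sigma_sets (space F) {Z k -` A \<inter> space F | k A. k \<le> n \<and> A \<in> sets S} \<subseteq> sets F"
    by (rule sets.sigma_sets_subset) (auto intro: measurable_sets assms)
  then show ?thesis
    by (simp add: sets_past_algebra assms)
qed

text \<open>
  A conditional expectation is characterised by its integrals over the events of the past
  only if the candidate is measurable with respect to the past. This is where the measurability
  of the kernel enters.
\<close>

lemma markov_chain_iff_markov_at:
  assumes K: "measurable_kernel S K"
  shows "markov_chain P S K Z \<longleftrightarrow>
    prob_space P \<and> (\<forall>n. Z n \<in> measurable P S) \<and> (\<forall>n. markov_at P S K Z n)"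
proof -
  have *: "(\<forall>B\<in>sets (past_algebra P S Z n).
        measure P ({\<omega> \<in> space P. Z (n + 1) \<omega> \<in> A} \<inter> B) =
        (\<integral>\<omega>. indicat_real B \<omega> * measure_pmf.prob (K (Z n \<omega>)) A \<partial>P)) \<longleftrightarrow>
     (AE \<omega> in P. real_cond_exp P (past_algebra P S Z n)
                     (indicat_real {\<omega> \<in> space P. Z (n + 1) \<omega> \<in> A}) \<omega>
                   = measure_pmf.prob (K (Z n \<omega>)) A)" (is "?L \<longleftrightarrow> ?R")
    if P: "prob_space P" and Z: "\<And>n. Z n \<in> measurable P S" and A: "A \<in> sets S" for n A
  proof -
    interpret prob_space P by fact
    let ?F = "past_algebra P S Z n" and ?C = "{\<omega> \<in> space P. Z (n + 1) \<omega> \<in> A}"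
    let ?k = "\<lambda>\<omega>. measure_pmf.prob (K (Z n \<omega>)) A"
    have F: "subalgebra P ?F"
      unfolding subalgebra_def by (simp add: past_algebra_subset_sets Z)
    interpret finite_measure_subalgebra P ?F by standard (rule F)
    have ZF: "Z n \<in> measurable ?F S"
      using measurable_space[OF Z] by (intro measurable_past_algebra) auto
    have kF: "?k \<in> borel_measurable ?F"
      using measurable_compose[OF ZF] K A unfolding measurable_kernel_def by blast
    have k[measurable]: "?k \<in> borel_measurable P"
      by (rule measurable_from_subalg[OF F kF])
    have [measurable]: "?C \<in> sets P"
      using measurable_sets[OF Z[of "n+1"] A] by (simp add: vimage_def Int_def conj_commute)
    have ik: "integrable P ?k"
      by (rule integrable_const_bound[where B=1]) auto
    have iC: "integrable P (indicat_real ?C)"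
      by (rule integrable_const_bound[where B=1]) auto
    have m: "measure P (?C \<inter> B) = (\<integral>\<omega>\<in>B. indicat_real ?C \<omega> \<partial>P)" if "B \<in> sets ?F" for B
    proof -
      have [measurable]: "B \<in> sets P" using that F by (auto simp: subalgebra_def)
      have "(\<integral>\<omega>\<in>B. indicat_real ?C \<omega> \<partial>P) = (\<integral>\<omega>. indicat_real (?C \<inter> B) \<omega> \<partial>P)"
        unfolding set_lebesgue_integral_def
        by (intro Bochner_Integration.integral_cong) (auto simp: indicator_def)
      then show ?thesis by simp
    qed
    show ?thesis
    proof
      assume ?L
      then show ?R
        using m by (intro real_cond_exp_charact ik iC kF) (auto simp: set_lebesgue_integral_def)
    next
      assume R: ?R
      show ?L
      proof
        fix B assume B: "B \<in> sets ?F"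
        then have BP[measurable]: "B \<in> sets P" using F by (auto simp: subalgebra_def)
        have "(\<integral>\<omega>\<in>B. indicat_real ?C \<omega> \<partial>P) =
            (\<integral>\<omega>\<in>B. real_cond_exp P ?F (indicat_real ?C) \<omega> \<partial>P)"
          by (rule real_cond_exp_intA[OF iC B])
        also have "\<dots> = (\<integral>\<omega>\<in>B. ?k \<omega> \<partial>P)"
          unfolding set_lebesgue_integral_def using R
          by (intro integral_cong_AE) auto
        finally show "measure P (?C \<inter> B) = (\<integral>\<omega>. indicat_real B \<omega> * ?k \<omega> \<partial>P)"
          using m[OF B] by (simp add: set_lebesgue_integral_def)
      qed
    qed
  qed
  show ?thesis
    unfolding markov_chain_def markov_at_def using * by meson
qed

text \<open>
  The past of a process which factors through \<open>T\<close> consists of the preimages of past events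
  of the factor. The map \<open>f\<close> relates the two time scales; it is the identity when a process is
  replaced by its law, and a translation when time is shifted.
\<close>

lemma sets_past_algebra_vimage:
  assumes T: "T \<in> space P \<rightarrow> space P'"
    and f: "f ` {..n'} = {..n}"
    and Z: "\<And>k \<omega>. k \<le> n' \<Longrightarrow> \<omega> \<in> space P \<Longrightarrow> Z' k (T \<omega>) = Z (f k) \<omega>"
  shows "sets (past_algebra P S Z n) =
    {T -` B \<inter> space P | B. B \<in> sets (past_algebra P' S Z' n')}"
proof -
  have "{Z k -` A \<inter> space P | k A. k \<le> n \<and> A \<in> sets S} =
      (\<Union>k\<in>f ` {..n'}. (\<lambda>A. Z k -` A \<inter> space P) ` sets S)"
    unfolding f by auto
  also have "\<dots> = (\<Union>k\<in>{..n'}. (\<lambda>A. T -` (Z' k -` A \<inter> space P') \<inter> space P) ` sets S)"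
    unfolding UN_simps(10)
  proof (intro SUP_cong refl image_cong)
    fix k A assume "k \<in> {..n'}"
    then show "Z (f k) -` A \<inter> space P = T -` (Z' k -` A \<inter> space P') \<inter> space P"
      using Z[of k] T by auto
  qed
  also have "\<dots> = {T -` B \<inter> space P | B.
      B \<in> (\<Union>k\<in>{..n'}. (\<lambda>A. Z' k -` A \<inter> space P') ` sets S)}"
    unfolding Setcompr_eq_image Collect_mem_eq image_UN image_image ..
  also have "(\<Union>k\<in>{..n'}. (\<lambda>A. Z' k -` A \<inter> space P') ` sets S) =
      {Z' k -` A \<inter> space P' | k A. k \<le> n' \<and> A \<in> sets S}"
    by auto
  finally show ?thesis
    unfolding sets_past_algebra sigma_sets_vimage_commute[OF T] by simp
qed

text \<open>
  The Markov property at a given time depends only on the law of the process.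
\<close>

lemma markov_at_distr_iff:
  fixes f :: "'t::linordered_semidom \<Rightarrow> 't"
  assumes K: "measurable_kernel S K"
    and T[measurable]: "T \<in> measurable P N"
    and f: "f ` {..n'} = {..n}" "f n' = n" "f (n' + 1) = n + 1"
    and Z': "\<And>k. Z' k \<in> measurable N S"
    and Z: "\<And>k \<omega>. \<omega> \<in> space P \<Longrightarrow> Z' k (T \<omega>) = Z (f k) \<omega>"
  shows "markov_at (distr P N T) S K Z' n' \<longleftrightarrow> markov_at P S K Z n"
proof -
  let ?P' = "distr P N T"
  have past: "sets (past_algebra P S Z n) =
    {T -` B \<inter> space P | B. B \<in> sets (past_algebra ?P' S Z' n')}"
  proof (rule sets_past_algebra_vimage[OF _ f(1)])
    show "T \<in> space P \<rightarrow> space ?P'"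
      using measurable_space[OF T] by auto
  qed (rule Z)
  have sub: "sets (past_algebra ?P' S Z' n') \<subseteq> sets N"
    by (rule order_trans[OF past_algebra_subset_sets[where F = N]]) (use Z' in auto)
  have "measure P ({\<omega> \<in> space P. Z (n + 1) \<omega> \<in> A} \<inter> (T -` B \<inter> space P)) =
        measure ?P' ({\<omega> \<in> space ?P'. Z' (n' + 1) \<omega> \<in> A} \<inter> B)"
    "(\<integral>\<omega>. indicat_real (T -` B \<inter> space P) \<omega> * measure_pmf.prob (K (Z n \<omega>)) A \<partial>P) =
        (\<integral>\<omega>. indicat_real B \<omega> * measure_pmf.prob (K (Z' n' \<omega>)) A \<partial>?P')"
    if A[measurable]: "A \<in> sets S" and B: "B \<in> sets (past_algebra ?P' S Z' n')" for A B
  proof -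
    note Z'[measurable]
    have BN[measurable]: "B \<in> sets N" using B sub by auto
    have Km: "(\<lambda>\<omega>. measure_pmf.prob (K (Z' n' \<omega>)) A) \<in> borel_measurable N"
      using measurable_compose[OF Z'] K A unfolding measurable_kernel_def by blast
    have C: "{\<omega> \<in> space N. Z' (n' + 1) \<omega> \<in> A} \<inter> B \<in> sets N" by measurable
    have "{\<omega> \<in> space P. Z (n + 1) \<omega> \<in> A} \<inter> (T -` B \<inter> space P) =
        T -` ({\<omega> \<in> space N. Z' (n' + 1) \<omega> \<in> A} \<inter> B) \<inter> space P"
      using Z[of _ "n'+1"] measurable_space[OF T] f(3) by auto
    then show "measure P ({\<omega> \<in> space P. Z (n + 1) \<omega> \<in> A} \<inter> (T -` B \<inter> space P)) =
        measure ?P' ({\<omega> \<in> space ?P'. Z' (n' + 1) \<omega> \<in> A} \<inter> B)"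
      using measure_distr[OF T C] by simp
    have "(\<integral>\<omega>. indicat_real B \<omega> * measure_pmf.prob (K (Z' n' \<omega>)) A \<partial>?P') =
        (\<integral>\<omega>. indicat_real B (T \<omega>) * measure_pmf.prob (K (Z' n' (T \<omega>))) A \<partial>P)"
      by (intro integral_distr T borel_measurable_times Km) simp
    also have "\<dots> = (\<integral>\<omega>. indicat_real (T -` B \<inter> space P) \<omega> * measure_pmf.prob (K (Z n \<omega>)) A \<partial>P)"
      using Z[of _ n'] f(2) by (intro Bochner_Integration.integral_cong) (auto simp: indicator_def)
    finally show "(\<integral>\<omega>. indicat_real (T -` B \<inter> space P) \<omega> * measure_pmf.prob (K (Z n \<omega>)) A \<partial>P) =
        (\<integral>\<omega>. indicat_real B \<omega> * measure_pmf.prob (K (Z' n' \<omega>)) A \<partial>?P')" ..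
  qed
  note eqs = this
  show ?thesis
  proof
    assume L: "markov_at ?P' S K Z' n'"
    show "markov_at P S K Z n"
      unfolding markov_at_def
    proof (intro ballI)
      fix A B assume A: "A \<in> sets S" and "B \<in> sets (past_algebra P S Z n)"
      then obtain B' where B': "B' \<in> sets (past_algebra ?P' S Z' n')" "B = T -` B' \<inter> space P"
        unfolding past by blast
      show "measure P ({\<omega> \<in> space P. Z (n + 1) \<omega> \<in> A} \<inter> B) =
        (\<integral>\<omega>. indicat_real B \<omega> * measure_pmf.prob (K (Z n \<omega>)) A \<partial>P)"
        unfolding B'(2) eqs[OF A B'(1)] using L A B'(1) unfolding markov_at_def by blast
    qed
  next
    assume R: "markov_at P S K Z n"
    show "markov_at ?P' S K Z' n'"
      unfolding markov_at_def
    proof (intro ballI)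
      fix A B assume A: "A \<in> sets S" and B: "B \<in> sets (past_algebra ?P' S Z' n')"
      then have B': "T -` B \<inter> space P \<in> sets (past_algebra P S Z n)"
        unfolding past by blast
      show "measure ?P' ({\<omega> \<in> space ?P'. Z' (n' + 1) \<omega> \<in> A} \<inter> B) =
        (\<integral>\<omega>. indicat_real B \<omega> * measure_pmf.prob (K (Z' n' \<omega>)) A \<partial>?P')"
        unfolding eqs[OF A B, symmetric] using R A B' unfolding markov_at_def by blast
    qed
  qed
qed

section \<open>Stationary chains on two-sided time\<close>

lemma measurable_path:
  assumes "\<And>k. Z k \<in> measurable P S"
  shows "(\<lambda>\<omega> k. Z k \<omega>) \<in> measurable P (PiM UNIV (\<lambda>_. S))"
proof (rule measurable_PiM_single')
  show "(\<lambda>\<omega> k. Z k \<omega>) \<in> space P \<rightarrow> (\<Pi>\<^sub>E i\<in>UNIV. space S)"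
    using measurable_space[OF assms] by auto
qed (rule assms)

text \<open>
  Stationarity under the shift by one implies invariance under all shifts, backwards as well,
  because the shift of the two-sided path space is invertible.
\<close>

lemma distr_shift_stationary:
  fixes Z :: "int \<Rightarrow> 'w \<Rightarrow> 's"
  assumes Z[measurable]: "\<And>k. Z k \<in> measurable P S" and st: "stationary_process P S Z"
  shows "distr P (PiM UNIV (\<lambda>_. S)) (\<lambda>\<omega> k. Z (k + n) \<omega>) =
         distr P (PiM UNIV (\<lambda>_. S)) (\<lambda>\<omega> k. Z k \<omega>)"
proof -
  let ?D = "\<lambda>n. distr P (PiM UNIV (\<lambda>_. S)) (\<lambda>\<omega> k. Z (k + n) \<omega>)"
  have step: "?D (n + 1) = ?D n" for n
  proof -
    have [measurable]: "(\<lambda>x k. x (k + n)) \<in> measurable (PiM UNIV (\<lambda>_. S)) (PiM UNIV (\<lambda>_. S))"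
      by (rule measurable_path) simp
    have "distr (distr P (PiM UNIV (\<lambda>_. S)) (\<lambda>\<omega> k. Z (k + 1) \<omega>)) (PiM UNIV (\<lambda>_. S)) (\<lambda>x k. x (k + n)) =
      distr (distr P (PiM UNIV (\<lambda>_. S)) (\<lambda>\<omega> k. Z k \<omega>)) (PiM UNIV (\<lambda>_. S)) (\<lambda>x k. x (k + n))"
      using st by (simp add: stationary_process_def)
    then show ?thesis
      by (simp add: distr_distr measurable_path comp_def algebra_simps)
  qed
  have "?D n = ?D 0"
  proof (induction n rule: int_induct[where k = 0])
    case (step2 i)
    then show ?case using step[of "i - 1"] by simp
  qed (simp_all add: step)
  then show ?thesis by simp
qed

text \<open>
  For a two-sided stationary process, the pasts at two times are translates of one another.
  Together with the invariance of the law, this moves the Markov property from time \<open>0\<close> to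
  any other time, in particular to negative times.
\<close>

lemma markov_at_all_times:
  fixes Z :: "int \<Rightarrow> 'w \<Rightarrow> 's"
  assumes K: "measurable_kernel S K"
    and Z[measurable]: "\<And>k. Z k \<in> measurable P S" and st: "stationary_process P S Z"
    and at0: "markov_at P S K Z 0"
  shows "markov_at P S K Z n"
proof -
  let ?law = "\<lambda>n. distr P (PiM UNIV (\<lambda>_. S)) (\<lambda>\<omega> k. Z (k + n) \<omega>)"
  have "(\<lambda>k. k + n) ` {..0} = {..n}" for n :: int
    using image_add_atMost[of n 0] by (simp add: add.commute)
  then have "markov_at (?law n) S K (\<lambda>k \<omega>. \<omega> k) 0 \<longleftrightarrow> markov_at P S K Z n" for n
    by (intro markov_at_distr_iff[where f = "\<lambda>k. k + n"] K)
      (auto intro: measurable_path)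
  moreover have "?law n = ?law 0"
    using distr_shift_stationary[OF Z st] by simp
  ultimately show ?thesis using at0 by metis
qed

lemma stationary_markov_chain_canonical:
  fixes Z :: "'t::linordered_semidom \<Rightarrow> 'w \<Rightarrow> 's"
  assumes K: "measurable_kernel S K" and Z: "stationary_markov_chain P S K Z"
  shows "stationary_markov_chain (distr P (PiM UNIV (\<lambda>_. S)) (\<lambda>\<omega> k. Z k \<omega>)) S K (\<lambda>k \<omega>. \<omega> k)"
proof -
  let ?N = "distr P (PiM UNIV (\<lambda>_. S)) (\<lambda>\<omega> k. Z k \<omega>)"
  have P: "prob_space P" and Zm[measurable]: "\<And>n. Z n \<in> measurable P S"
    and at: "\<And>n. markov_at P S K Z n" and st: "stationary_process P S Z"
    using Z by (auto simp: stationary_markov_chain_def markov_chain_iff_markov_at[OF K])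
  have "prob_space ?N"
    by (rule prob_space.prob_space_distr[OF P]) (simp add: measurable_path)
  moreover have "markov_at ?N S K (\<lambda>k \<omega>. \<omega> k) n" for n
    using at by (subst markov_at_distr_iff[where f = "\<lambda>k. k" and Z = Z and n = n]) (auto intro: K measurable_path)
  moreover have "stationary_process ?N S (\<lambda>k \<omega>. \<omega> k)"
  proof -
    have [measurable]: "(\<lambda>x k. x (k + 1)) \<in> measurable (PiM UNIV (\<lambda>_::'t. S)) (PiM UNIV (\<lambda>_. S))"
      by (rule measurable_path) simp
    show ?thesis
      using st by (simp add: stationary_process_def distr_distr measurable_path comp_def)
  qed
  ultimately show ?thesis
    by (simp add: stationary_markov_chain_def markov_chain_iff_markov_at[OF K])
qed

text \<open>
  The past from time \<open>0\<close> on is smaller than the whole past, but the conditional probability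
  given the whole past is a function of the present state, so it does not change.
\<close>

lemma stationary_markov_chain_restrict_nat:
  fixes Z :: "int \<Rightarrow> 'w \<Rightarrow> 's"
  assumes K: "measurable_kernel S K" and Z: "stationary_markov_chain P S K Z"
  shows "stationary_markov_chain P S K (\<lambda>n::nat. Z (int n))"
proof -
  have P: "prob_space P" and Zm[measurable]: "\<And>n. Z n \<in> measurable P S"
    and at: "\<And>n. markov_at P S K Z n" and st: "stationary_process P S Z"
    using Z by (auto simp: stationary_markov_chain_def markov_chain_iff_markov_at[OF K])
  have "markov_at P S K (\<lambda>n::nat. Z (int n)) n" for n
  proof -
    have "sets (past_algebra P S (\<lambda>n::nat. Z (int n)) n) \<subseteq> sets (past_algebra P S Z (int n))"
      using measurable_space[OF Zm] by (intro past_algebra_subset_sets measurable_past_algebra) auto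
    with at[of "int n"] show ?thesis
      unfolding markov_at_def by (auto simp: add.commute)
  qed
  moreover have "stationary_process P S (\<lambda>n::nat. Z (int n))"
  proof -
    have [measurable]: "(\<lambda>x k. x (int k)) \<in> measurable (PiM UNIV (\<lambda>_. S)) (PiM UNIV (\<lambda>_. S))"
      by (rule measurable_path) simp
    have "distr (distr P (PiM UNIV (\<lambda>_. S)) (\<lambda>\<omega> k. Z (k + 1) \<omega>)) (PiM UNIV (\<lambda>_. S)) (\<lambda>x k. x (int k)) =
      distr (distr P (PiM UNIV (\<lambda>_. S)) (\<lambda>\<omega> k. Z k \<omega>)) (PiM UNIV (\<lambda>_. S)) (\<lambda>x k. x (int k))"
      using st by (simp add: stationary_process_def)
    then show ?thesis
      by (simp add: stationary_process_def distr_distr measurable_path comp_def add.commute)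
  qed
  ultimately show ?thesis
    using P by (simp add: stationary_markov_chain_def markov_chain_iff_markov_at[OF K])
qed

section \<open>The final run of a word and its context\<close>

text \<open>
  The memory as a function of the word alone. For a non-constant word, the least position with
  a letter other than the last one is the length of the final run, since positions start at
  \<open>0\<close>.
\<close>

definition run_length :: "left_word \<Rightarrow> enat" where
  "run_length u = (if \<forall>j. u j = u 0 then \<infinity> else enat (LEAST j. u j \<noteq> u 0))"

text \<open>
  This condition determines \<open>run_length\<close>, so that identities between
  memories are checked on finite numbers \<open>k\<close>, with no distinction between finite and
  infinite memory.
\<close>

lemma enat_less_run_length_iff: "enat k < run_length u \<longleftrightarrow> (\<forall>j\<le>k. u j = u 0)"
proof (cases "\<forall>j. u j = u 0")
  case False
  define m where "m = (LEAST j. u j \<noteq> u 0)"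
  have "u m \<noteq> u 0"
    unfolding m_def by (rule LeastI_ex) (use False in blast)
  moreover have "u j = u 0" if "j < m" for j
    using that not_less_Least[of j "\<lambda>j. u j \<noteq> u 0"] unfolding m_def by blast
  ultimately have "k < m \<longleftrightarrow> (\<forall>j\<le>k. u j = u 0)"
    by (meson le_less_trans not_le)
  moreover have "run_length u = enat m"
    using False unfolding run_length_def m_def by simp
  ultimately show ?thesis by simp
qed (simp add: run_length_def)

lemma enat_eqI_less:
  assumes "\<And>k. enat k < a \<longleftrightarrow> enat k < b"
  shows "a = b"
  using assms[of "case a of enat m \<Rightarrow> m | \<infinity> \<Rightarrow> case b of enat m \<Rightarrow> m | \<infinity> \<Rightarrow> 0"]
    assms[of "case b of enat m \<Rightarrow> m | \<infinity> \<Rightarrow> 0"]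
  by (cases a; cases b) auto

lemma one_le_run_length: "1 \<le> run_length u"
  using enat_less_run_length_iff[of 0 u] by (simp add: one_eSuc ileI1 zero_enat_def)

lemma memory_eq_run_length:
  "memory U n \<omega> = run_length (\<lambda>k. letter U (int n - int k) \<omega>)"
proof (rule enat_eqI_less)
  fix k
  let ?I = "{i. \<forall>j\<le>i. letter U (int n - int j) \<omega> = letter U (int n) \<omega>}"
  have "enat k \<le> (SUP i\<in>?I. enat i) \<longleftrightarrow> k \<in> ?I"
  proof
    assume le: "enat k \<le> (SUP i\<in>?I. enat i)"
    show "k \<in> ?I"
    proof (rule ccontr)
      assume k: "k \<notin> ?I"
      then have "i < k" if "i \<in> ?I" for i
        using that by (auto simp: not_le[symmetric] dest: le_trans)
      then have "(SUP i\<in>?I. enat i) \<le> enat (k - 1)"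
        by (intro SUP_least) (simp add: Suc_le_eq[symmetric] le_diff_conv2)
      with le have "enat k \<le> enat (k - 1)" by (rule order_trans)
      moreover have "k \<noteq> 0" using k by (intro notI) auto
      ultimately show False by simp
    qed
  qed (rule SUP_upper)
  moreover have "enat k < 1 + x \<longleftrightarrow> enat k \<le> x" for x
    by (cases x) (auto simp: one_enat_def)
  ultimately show "enat k < memory U n \<omega> \<longleftrightarrow>
      enat k < run_length (\<lambda>k. letter U (int n - int k) \<omega>)"
    by (simp add: memory_def enat_less_run_length_iff)
qed

definition run_state :: "left_word \<Rightarrow> bool \<times> enat" where
  "run_state u = (u 0, run_length u)"

text \<open>
  A step of the letter/memory chain in which the new letter is \<open>l\<close>. Since
  \<open>eSuc \<infinity> = \<infinity>\<close>, an infinite memory stays infinite when the letter is kept.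
\<close>

definition next_state :: "bool \<times> enat \<Rightarrow> bool \<Rightarrow> bool \<times> enat" where
  "next_state s l = (l, if l = fst s then eSuc (snd s) else 1)"

lemma enat_less_eSuc_iff:
  "enat k < eSuc n \<longleftrightarrow> k = 0 \<or> enat (k - 1) < n"
  by (cases n; cases k) (auto simp: eSuc_enat)

lemma enat_less_one_iff: "enat k < 1 \<longleftrightarrow> k = 0"
  by (simp add: one_enat_def)

lemma all_le_append_letter:
  "(\<forall>j\<le>k. append_letter u l j = l) \<longleftrightarrow> k = 0 \<or> (l = u 0 \<and> (\<forall>j\<le>k - 1. u j = u 0))"
proof (cases k)
  case 0
  then show ?thesis by (simp add: append_letter_def)
next
  case (Suc m)
  have "(\<forall>j\<le>Suc m. append_letter u l j = l) \<longleftrightarrow> (\<forall>j\<le>m. u j = l)"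
    unfolding append_letter_def by (auto split: nat.split simp: Suc_le_eq less_Suc_eq_le)
  also have "\<dots> \<longleftrightarrow> l = u 0 \<and> (\<forall>j\<le>m. u j = u 0)" by auto
  finally show ?thesis using Suc by simp
qed

text \<open>
  The semiconjugacy behind both halves of the theorem: appending a letter to a word acts on its
  last letter and final run as a step of the letter/memory chain.
\<close>

lemma run_state_append_letter:
  "run_state (append_letter u l) = next_state (run_state u) l"
proof -
  have 0: "append_letter u l 0 = l" by (simp add: append_letter_def)
  have "run_length (append_letter u l) = (if l = u 0 then eSuc (run_length u) else 1)"
  proof (rule enat_eqI_less)
    fix k
    have "enat k < run_length (append_letter u l) \<longleftrightarrow> (\<forall>j\<le>k. append_letter u l j = l)"
      unfolding enat_less_run_length_iff 0 ..
    also have "\<dots> \<longleftrightarrow> k = 0 \<or> (l = u 0 \<and> enat (k - 1) < run_length u)"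
      unfolding enat_less_run_length_iff by (rule all_le_append_letter)
    also have "\<dots> \<longleftrightarrow> enat k < (if l = u 0 then eSuc (run_length u) else 1)"
      using enat_less_eSuc_iff[of k "run_length u"] enat_less_one_iff[of k] by auto
    finally show "enat k < run_length (append_letter u l) \<longleftrightarrow>
        enat k < (if l = u 0 then eSuc (run_length u) else 1)" .
  qed
  then show ?thesis
    by (simp add: run_state_def next_state_def 0)
qed

definition comb_ctxt :: "bool \<times> enat \<Rightarrow> ctxt" where
  "comb_ctxt s = (case snd s of enat m \<Rightarrow> run_ctxt (fst s) m | \<infinity> \<Rightarrow> const_ctxt (fst s))"

lemma double_comb_eq: "double_comb = {comb_ctxt s | s. 1 \<le> snd s}" (is "_ = ?R")
proof -
  have *: "(\<exists>s. c = comb_ctxt s \<and> 1 \<le> snd s) \<longleftrightarrow>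
      (\<exists>x. (\<exists>m\<ge>1. c = run_ctxt x m) \<or> c = const_ctxt x)" for c
  proof
    assume "\<exists>s. c = comb_ctxt s \<and> 1 \<le> snd s"
    then obtain x n where "c = comb_ctxt (x, n)" "1 \<le> n" by auto
    then show "\<exists>x. (\<exists>m\<ge>1. c = run_ctxt x m) \<or> c = const_ctxt x"
      by (cases n) (auto simp: comb_ctxt_def one_enat_def)
  next
    assume "\<exists>x. (\<exists>m\<ge>1. c = run_ctxt x m) \<or> c = const_ctxt x"
    then obtain x where "(\<exists>m\<ge>1. c = run_ctxt x m) \<or> c = const_ctxt x" ..
    then show "\<exists>s. c = comb_ctxt s \<and> 1 \<le> snd s"
    proof
      assume "\<exists>m\<ge>1. c = run_ctxt x m"
      then obtain m where "m \<ge> 1" "c = run_ctxt x m" by auto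
      then show ?thesis
        by (intro exI[of _ "(x, enat m)"]) (simp add: comb_ctxt_def one_enat_def)
    next
      assume "c = const_ctxt x"
      then show ?thesis by (intro exI[of _ "(x, \<infinity>)"]) (simp add: comb_ctxt_def)
    qed
  qed
  have "double_comb = {c. \<exists>x. (\<exists>m\<ge>1. c = run_ctxt x m) \<or> c = const_ctxt x}"
    unfolding double_comb_def by (auto simp: ex_bool_eq)
  also have "\<dots> = ?R" using * by auto
  finally show ?thesis .
qed

lemma reads_comb_ctxt_iff:
  assumes "1 \<le> snd s"
  shows "reads_ctxt u (comb_ctxt s) \<longleftrightarrow> s = run_state u"
proof (cases s)
  case (Pair x n)
  show ?thesis
  proof (cases n)
    case (enat m)
    then have m: "m \<ge> 1" using assms Pair by (simp add: one_enat_def)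
    have "reads_ctxt u (comb_ctxt s) \<longleftrightarrow>
        (\<forall>k<Suc m. u k = (replicate m x @ [\<not> x]) ! k)"
      by (simp add: Pair enat comb_ctxt_def run_ctxt_def)
    also have "\<dots> \<longleftrightarrow> (\<forall>k<m. u k = x) \<and> u m = (\<not> x)"
      unfolding All_less_Suc by (auto simp: nth_append)
    also have "\<dots> \<longleftrightarrow> u 0 = x \<and> (\<forall>j\<le>m - 1. u j = u 0) \<and> \<not> (\<forall>j\<le>m. u j = u 0)"
    proof -
      have "(\<forall>k<m. u k = x) \<longleftrightarrow> u 0 = x \<and> (\<forall>j\<le>m - 1. u j = u 0)"
      proof -
        have "k < m \<longleftrightarrow> k \<le> m - 1" for k using m by auto
        then show ?thesis by (metis le0)
      qed
      moreover have "(\<forall>j\<le>m. u j = u 0) \<longleftrightarrow> (\<forall>j\<le>m - 1. u j = u 0) \<and> u m = u 0"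
      proof -
        have "k \<le> m \<longleftrightarrow> k \<le> m - 1 \<or> k = m" for k using m by auto
        then show ?thesis by metis
      qed
      ultimately show ?thesis by blast
    qed
    also have "\<dots> \<longleftrightarrow> u 0 = x \<and> run_length u = enat m"
    proof -
      have "enat (m - 1) < N \<and> \<not> enat m < N \<longleftrightarrow> N = enat m" for N
        using m by (cases N) auto
      then show ?thesis unfolding enat_less_run_length_iff[symmetric] by blast
    qed
    finally show ?thesis by (auto simp: Pair enat run_state_def)
  next
    case infinity
    have "(\<forall>j. u j = u 0) \<longleftrightarrow> run_length u = \<infinity>"
      by (simp add: run_length_def)
    moreover have "reads_ctxt u (comb_ctxt s) \<longleftrightarrow> u 0 = x \<and> (\<forall>j. u j = u 0)"
      unfolding Pair infinity comb_ctxt_def const_ctxt_def by (simp add: fun_eq_iff) metis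
    ultimately show ?thesis
      by (auto simp only: Pair infinity run_state_def)
  qed
qed

text \<open>
  Exactly one context is read off a word, namely the one parametrised by the last letter and
  the length of the final run. This is why the transitions of the VLMC depend on the word only
  through the state of the letter/memory chain.
\<close>

lemma pref_double_comb: "pref double_comb u = comb_ctxt (run_state u)"
  unfolding pref_def
proof (rule the_equality)
  have "1 \<le> snd (run_state u)" by (simp add: run_state_def one_le_run_length)
  then show "comb_ctxt (run_state u) \<in> double_comb \<and> reads_ctxt u (comb_ctxt (run_state u))"
    using reads_comb_ctxt_iff[of "run_state u" u] unfolding double_comb_eq by blast
next
  fix c assume "c \<in> double_comb \<and> reads_ctxt u c"
  then show "c = comb_ctxt (run_state u)"
    unfolding double_comb_eq using reads_comb_ctxt_iff by auto
qed

section \<open>The two transition kernels\<close>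

definition letter_law :: "(nat \<Rightarrow> enat \<Rightarrow> real) \<Rightarrow> bool \<times> enat \<Rightarrow> bool pmf" where
  "letter_law \<alpha> s =
     map_pmf (\<lambda>switch. if switch then \<not> fst s else fst s)
       (bernoulli_pmf (\<alpha> (letter_index (fst s)) (snd s)))"

lemma letter_memory_kernel_eq:
  "letter_memory_kernel \<alpha> s = map_pmf (next_state s) (letter_law \<alpha> s)"
proof (cases s)
  case (Pair x n)
  show ?thesis
    unfolding Pair letter_memory_kernel_def letter_law_def pmf.map_comp comp_def prod.case
    by (intro map_pmf_cong refl) (auto simp: next_state_def eSuc_def split: enat.split)
qed

lemma bool_pmf_eqI:
  fixes p q :: "bool pmf"
  assumes "pmf p l = pmf q l"
  shows "p = q"
proof (rule pmf_eqI)
  have "pmf p True + pmf p False = 1" for p :: "bool pmf"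
    using sum_pmf_eq_1[OF finite subset_UNIV, of p] by (simp add: UNIV_bool)
  from this[of p] this[of q] show "pmf p i = pmf q i" for i
    using assms by (cases i; cases l) auto
qed

lemma pmf_letter_law_not:
  assumes "0 \<le> \<alpha> (letter_index x) n" "\<alpha> (letter_index x) n \<le> 1"
  shows "pmf (letter_law \<alpha> (x, n)) (\<not> x) = \<alpha> (letter_index x) n"
proof -
  have "inj (\<lambda>switch. if switch then \<not> x else x)" by (auto simp: inj_def)
  from pmf_map_inj'[OF this, of _ True] show ?thesis
    using assms by (simp only: letter_law_def fst_conv snd_conv if_True pmf_bernoulli_True)
qed

text \<open>
  A law on two letters is determined by one of its values, here the probability of switching.
  The bounds on \<open>\<alpha>\<close> are needed because \<^const>\<open>bernoulli_pmf\<close> truncates its parameter to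
  the unit interval.
\<close>

lemma comb_probabilities_iff:
  assumes alpha: "\<forall>i\<in>{1, 2}. \<forall>n\<ge>1. 0 < \<alpha> i n \<and> \<alpha> i n < 1"
  shows "comb_probabilities \<alpha> q \<longleftrightarrow> (\<forall>s. 1 \<le> snd s \<longrightarrow> q (comb_ctxt s) = letter_law \<alpha> s)"
proof -
  have "q (comb_ctxt (x, n)) = letter_law \<alpha> (x, n) \<longleftrightarrow>
      pmf (q (comb_ctxt (x, n))) (\<not> x) = \<alpha> (letter_index x) n" if "1 \<le> n" for x n
  proof -
    have "pmf (letter_law \<alpha> (x, n)) (\<not> x) = \<alpha> (letter_index x) n"
      using alpha that
      by (intro pmf_letter_law_not) (auto simp: letter_index_def intro: less_imp_le)
    then show ?thesis by (metis bool_pmf_eqI)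
  qed
  then have "(\<forall>s. 1 \<le> snd s \<longrightarrow> q (comb_ctxt s) = letter_law \<alpha> s) \<longleftrightarrow>
      (\<forall>x n. 1 \<le> n \<longrightarrow> pmf (q (comb_ctxt (x, n))) (\<not> x) = \<alpha> (letter_index x) n)"
    by auto
  also have "\<dots> \<longleftrightarrow> (\<forall>x. (\<forall>m\<ge>1. pmf (q (run_ctxt x m)) (\<not> x) = \<alpha> (letter_index x) (enat m)) \<and>
      pmf (q (const_ctxt x)) (\<not> x) = \<alpha> (letter_index x) \<infinity>)"
  proof -
    have all_enat: "(\<forall>n\<ge>1. Q n) \<longleftrightarrow> (\<forall>m\<ge>1. Q (enat m)) \<and> Q \<infinity>" for Q
      by (metis enat.exhaust enat_ord_simps(1) enat_ord_simps(3) one_enat_def)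
    show ?thesis unfolding all_enat by (simp add: comb_ctxt_def)
  qed
  also have "\<dots> \<longleftrightarrow> comb_probabilities \<alpha> q"
    by (auto simp: comb_probabilities_def all_bool_eq letter_index_def)
  finally show ?thesis by simp
qed

lemma comb_probabilities_ex:
  assumes alpha: "\<forall>i\<in>{1, 2}. \<forall>n\<ge>1. 0 < \<alpha> i n \<and> \<alpha> i n < 1"
  shows "\<exists>p. comb_probabilities \<alpha> p"
proof -
  \<comment> \<open>The inverse of \<open>comb_ctxt\<close>; a finite context has one letter more than its run.\<close>
  define state where "state c = (case c of
      Finite_ctxt w \<Rightarrow> (hd w, enat (length w - 1)) | Infinite_ctxt v \<Rightarrow> (v 0, \<infinity>))" for c
  have "state (comb_ctxt s) = s" if "1 \<le> snd s" for s
    using that by (cases s; cases "snd s")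
      (auto simp: state_def comb_ctxt_def run_ctxt_def const_ctxt_def one_enat_def hd_append)
  then have "comb_probabilities \<alpha> (\<lambda>c. letter_law \<alpha> (state c))"
    using comb_probabilities_iff[OF alpha] by simp
  then show ?thesis by (rule exI[where P = "comb_probabilities \<alpha>"])
qed

lemma vlmc_kernel_double_comb:
  assumes alpha: "\<forall>i\<in>{1, 2}. \<forall>n\<ge>1. 0 < \<alpha> i n \<and> \<alpha> i n < 1"
    and q: "comb_probabilities \<alpha> q"
  shows "vlmc_kernel double_comb q u = map_pmf (append_letter u) (letter_law \<alpha> (run_state u))"
  using q unfolding vlmc_kernel_def pref_double_comb comb_probabilities_iff[OF alpha]
  by (simp add: run_state_def one_le_run_length)

text \<open>
  Both kernels draw the next letter from the same law, and \<open>run_state\<close> turns appending that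
  letter into \<open>next_state\<close>.
\<close>

lemma map_run_state_vlmc_kernel:
  assumes alpha: "\<forall>i\<in>{1, 2}. \<forall>n\<ge>1. 0 < \<alpha> i n \<and> \<alpha> i n < 1"
    and q: "comb_probabilities \<alpha> q"
  shows "map_pmf run_state (vlmc_kernel double_comb q u) = letter_memory_kernel \<alpha> (run_state u)"
  unfolding vlmc_kernel_double_comb[OF alpha q] letter_memory_kernel_eq pmf.map_comp comp_def
    run_state_append_letter ..

section \<open>Measurability of words and states\<close>

lemma space_left_word_space [simp]: "space left_word_space = UNIV"
  by (simp add: left_word_space_def space_PiM)

lemma space_letter_memory_space [simp]: "space letter_memory_space = UNIV \<times> {1..}"
  by (simp add: letter_memory_space_def)

lemma measurable_left_word_component [measurable]:
  "(\<lambda>u. u k) \<in> measurable left_word_space (count_space UNIV)"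
  unfolding left_word_space_def by measurable

lemma measurable_left_wordI:
  assumes "\<And>k. (\<lambda>\<omega>. f \<omega> k) \<in> measurable P (count_space UNIV)"
  shows "f \<in> measurable P left_word_space"
  unfolding left_word_space_def by (rule measurable_path[of "\<lambda>k \<omega>. f \<omega> k"]) (rule assms)

lemma measurable_append_letter [measurable]:
  "(\<lambda>u. append_letter u l) \<in> measurable left_word_space left_word_space"
proof (rule measurable_left_wordI)
  fix k show "(\<lambda>u. append_letter u l k) \<in> measurable left_word_space (count_space UNIV)"
    by (cases k) (simp_all add: append_letter_def)
qed

lemma measurable_run_state [measurable]:
  "run_state \<in> measurable left_word_space letter_memory_space"
  unfolding letter_memory_space_def
proof (subst measurable_count_space_eq2_countable, intro conjI ballI)
  fix s :: "bool \<times> enat"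
  have "run_state u = s \<longleftrightarrow> u 0 = fst s \<and> (\<forall>k. enat k < snd s \<longleftrightarrow> (\<forall>j\<in>{..k}. u j = u 0))" for u
  proof -
    have "run_length u = snd s \<longleftrightarrow> (\<forall>k. enat k < snd s \<longleftrightarrow> enat k < run_length u)"
      using enat_eqI_less[of "run_length u" "snd s"] by auto
    then show ?thesis
      unfolding run_state_def prod_eq_iff fst_conv snd_conv enat_less_run_length_iff atMost_iff Ball_def
      by blast
  qed
  note run_state_eq_iff = this
  have "run_state -` {s} \<inter> space left_word_space = {u \<in> space left_word_space. run_state u = s}"
    by blast
  also have "\<dots> = {u \<in> space left_word_space. u 0 = fst s \<and> (\<forall>k. enat k < snd s \<longleftrightarrow> (\<forall>j\<in>{..k}. u j = u 0))}"
    unfolding run_state_eq_iff ..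
  also have "\<dots> \<in> sets left_word_space" by measurable
  finally show "run_state -` {s} \<inter> space left_word_space \<in> sets left_word_space" .
qed (auto simp: run_state_def one_le_run_length)

lemma measurable_kernel_letter_memory:
  "measurable_kernel letter_memory_space (letter_memory_kernel \<alpha>)"
  unfolding measurable_kernel_def letter_memory_space_def by simp

lemma prob_map_bool_pmf:
  fixes p :: "bool pmf"
  shows "measure_pmf.prob (map_pmf f p) A = (\<Sum>l\<in>UNIV. pmf p l * indicat_real A (f l))"
proof -
  have "measure_pmf.prob (map_pmf f p) A = measure_pmf.expectation p (indicat_real (f -` A))"
    by (simp add: measure_map_pmf)
  also have "\<dots> = (\<Sum>l\<in>UNIV. pmf p l * indicat_real (f -` A) l)"
    by (subst integral_measure_pmf_real[where A=UNIV]) (auto simp: mult.commute)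
  finally show ?thesis by (simp add: indicator_def)
qed

lemma measurable_kernel_vlmc_double_comb:
  assumes alpha: "\<forall>i\<in>{1, 2}. \<forall>n\<ge>1. 0 < \<alpha> i n \<and> \<alpha> i n < 1"
    and q: "comb_probabilities \<alpha> q"
  shows "measurable_kernel left_word_space (vlmc_kernel double_comb q)"
proof -
  have "(\<lambda>u. pmf (letter_law \<alpha> (run_state u)) l) \<in> borel_measurable left_word_space" for l
    by (rule measurable_compose[OF measurable_run_state]) (simp add: letter_memory_space_def)
  moreover have "(\<lambda>u. indicat_real A (append_letter u l)) \<in> borel_measurable left_word_space"
    if "A \<in> sets left_word_space" for A l
    using that by (intro measurable_compose[OF measurable_append_letter]) simp
  ultimately show ?thesis
    unfolding measurable_kernel_def vlmc_kernel_double_comb[OF alpha q] prob_map_bool_pmf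
    by (intro ballI borel_measurable_sum borel_measurable_times) auto
qed

section \<open>From the letter/memory chain to the words\<close>

text \<open>
  Transitions of probability zero almost surely do not occur. The structure of the paths of
  both chains is extracted from their kernels by means of this lemma.
\<close>

lemma markov_at_AE_avoid:
  assumes P: "prob_space P" and Z[measurable]: "\<And>n. Z n \<in> measurable P S"
    and at: "markov_at P S K Z n"
    and G: "G \<in> sets S" and A: "A \<in> sets S"
    and null: "\<And>x. x \<in> G \<Longrightarrow> measure_pmf.prob (K x) A = 0"
  shows "AE \<omega> in P. Z n \<omega> \<in> G \<longrightarrow> Z (n + 1) \<omega> \<notin> A"
proof -
  interpret prob_space P by fact
  let ?B = "Z n -` G \<inter> space P" and ?C = "{\<omega> \<in> space P. Z (n + 1) \<omega> \<in> A}"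
  note G[measurable] A[measurable]
  have CB: "?C \<inter> ?B \<in> sets P" by measurable
  have "?B \<in> sets (past_algebra P S Z n)"
    unfolding sets_past_algebra by (rule sigma_sets.Basic) (use G in blast)
  then have "measure P (?C \<inter> ?B) =
      (\<integral>\<omega>. indicat_real ?B \<omega> * measure_pmf.prob (K (Z n \<omega>)) A \<partial>P)"
    using at A unfolding markov_at_def by blast
  also have "\<dots> = (\<integral>\<omega>. 0 \<partial>P)"
    using null by (intro Bochner_Integration.integral_cong) (auto simp: indicator_def)
  finally have "measure P (?C \<inter> ?B) = 0" by simp
  then have "AE \<omega> in P. \<omega> \<notin> ?C \<inter> ?B"
    using CB by (intro AE_not_in) (simp add: null_sets_def emeasure_eq_measure)
  with AE_space show ?thesis
    by eventually_elim auto
qed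

lemma word_at_next_time:
  fixes X :: "int \<Rightarrow> bool"
  shows "(\<lambda>k. X (n + 1 - int k)) = append_letter (\<lambda>k. X (n - int k)) (X (n + 1))"
  by (auto simp: append_letter_def fun_eq_iff split: nat.split)

text \<open>
  Induction on \<open>k\<close>, going back in time. If the letter was just switched, then the memory and the
  final run are both \<open>1\<close>; otherwise both exceed by one their values one step earlier.
  Comparing with finite \<open>k\<close> only makes the induction cover infinite memories too.
\<close>

lemma memory_determined_by_letters:
  fixes X :: "int \<Rightarrow> bool" and M :: "int \<Rightarrow> enat"
  assumes pos: "\<And>n. 1 \<le> M n"
    and step: "\<And>n. (X (n + 1), M (n + 1)) = next_state (X n, M n) (X (n + 1))"
  shows "(X n, M n) = run_state (\<lambda>k. X (n - int k))"
proof -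
  have "enat k < M n \<longleftrightarrow> enat k < run_length (\<lambda>k. X (n - int k))" for k
  proof (induction k arbitrary: n)
    case 0
    have "enat 0 < x" if "1 \<le> x" for x
      using that by (cases x) (auto simp: one_enat_def)
    then show ?case using pos one_le_run_length by blast
  next
    case (Suc k)
    let ?W = "\<lambda>n k. X (n - int k)"
    have "?W n = append_letter (?W (n - 1)) (X n)"
      using word_at_next_time[of X "n - 1"] by simp
    then have "run_state (?W n) = next_state (run_state (?W (n - 1))) (X n)"
      using run_state_append_letter[of "?W (n - 1)" "X n"] by simp
    then have "run_length (?W n) =
        (if X n = X (n - 1) then eSuc (run_length (?W (n - 1))) else 1)"
      by (simp add: run_state_def next_state_def)
    moreover have "M n = (if X n = X (n - 1) then eSuc (M (n - 1)) else 1)"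
      using step[of "n - 1"] by (simp add: next_state_def)
    ultimately show ?case
      using Suc.IH[of "n - 1"] enat_less_eSuc_iff[of "Suc k"] by auto
  qed
  then have "M n = run_length (\<lambda>k. X (n - int k))" by (rule enat_eqI_less)
  then show ?thesis by (simp add: run_state_def)
qed

lemma prob_letter_memory_kernel_letter:
  "measure_pmf.prob (letter_memory_kernel \<alpha> s) ({l} \<times> {1..}) = pmf (letter_law \<alpha> s) l"
proof -
  have "1 \<le> eSuc n" for n by (simp add: one_eSuc)
  then have "next_state s l' \<in> {l} \<times> {1..} \<longleftrightarrow> l' = l" for l'
    by (auto simp: next_state_def)
  then show ?thesis
    unfolding letter_memory_kernel_eq prob_map_bool_pmf
    by (cases l) (simp_all add: indicator_def UNIV_bool)
qed

text \<open>
  Every transition of the letter/memory chain has the form \<open>next_state\<close>, so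
  almost every path satisfies the recursion at all times. Two-sided time is essential: the
  recursion determines the memory from the letters only if there is no first time.
\<close>

lemma memory_eq_run_length_AE:
  fixes X :: "int \<Rightarrow> 'w \<Rightarrow> bool" and M :: "int \<Rightarrow> 'w \<Rightarrow> enat"
  assumes mc: "markov_chain P letter_memory_space (letter_memory_kernel \<alpha>) (\<lambda>n \<omega>. (X n \<omega>, M n \<omega>))"
  shows "AE \<omega> in P. \<forall>n. (X n \<omega>, M n \<omega>) = run_state (\<lambda>k. X (n - int k) \<omega>)"
proof -
  define Z where "Z n \<omega> = (X n \<omega>, M n \<omega>)" for n \<omega>
  have P: "prob_space P" and Z: "\<And>n. Z n \<in> measurable P letter_memory_space"
    and at: "\<And>n. markov_at P letter_memory_space (letter_memory_kernel \<alpha>) Z n"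
    using mc unfolding Z_def[abs_def] markov_chain_iff_markov_at[OF measurable_kernel_letter_memory]
    by blast+
  have "AE \<omega> in P. Z n \<omega> \<in> {s} \<longrightarrow>
      Z (n + 1) \<omega> \<notin> {t \<in> UNIV \<times> {1..}. t \<noteq> next_state s (fst t)}"
    if s: "s \<in> UNIV \<times> {1..}" for n s
  proof (rule markov_at_AE_avoid[OF P Z at])
    show "{s} \<in> sets letter_memory_space"
      "{t \<in> UNIV \<times> {1..}. t \<noteq> next_state s (fst t)} \<in> sets letter_memory_space"
      using s by (auto simp: letter_memory_space_def)
    show "measure_pmf.prob (letter_memory_kernel \<alpha> x)
        {t \<in> UNIV \<times> {1..}. t \<noteq> next_state s (fst t)} = 0" if "x \<in> {s}" for x
      using that unfolding letter_memory_kernel_eq prob_map_bool_pmf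
      by (auto simp: indicator_def next_state_def)
  qed
  then have "AE \<omega> in P. \<forall>n. \<forall>s\<in>UNIV \<times> {1..}. Z n \<omega> \<in> {s} \<longrightarrow>
      Z (n + 1) \<omega> \<notin> {t \<in> UNIV \<times> {1..}. t \<noteq> next_state s (fst t)}"
    by (simp only: AE_all_countable AE_ball_countable[OF countableI_type]) blast
  with AE_space show ?thesis
  proof eventually_elim
    case (elim \<omega>)
    have Zs: "Z n \<omega> \<in> UNIV \<times> {1..}" for n
      using measurable_space[OF Z elim(1)] by simp
    show ?case
    proof (intro allI memory_determined_by_letters)
      fix n
      show "1 \<le> M n \<omega>" using Zs[of n] by (simp add: Z_def)
      show "(X (n + 1) \<omega>, M (n + 1) \<omega>) = next_state (X n \<omega>, M n \<omega>) (X (n + 1) \<omega>)"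
        using elim(2) Zs[of n] Zs[of "n + 1"] unfolding Z_def by auto
    qed
  qed
qed

lemma word_process_Suc:
  "word_process X (n + 1) \<omega> = append_letter (word_process X n \<omega>) (X (int n + 1) \<omega>)"
  using word_at_next_time[of "\<lambda>k. X k \<omega>" "int n"]
  by (simp add: word_process_def add.commute)

text \<open>
  The word up to time \<open>n\<close> is a function of the past of the letter/memory chain, so its past is
  the smaller one. An event for the next word splits according to the next letter into two events
  whose remaining part lies in the past of the chain. The Markov property of the chain applies to
  each of them, and its transition probability is a function of the current word almost surely.
\<close>

lemma stationary_vlmc_word_process:
  fixes X :: "int \<Rightarrow> 'w \<Rightarrow> bool" and M :: "int \<Rightarrow> 'w \<Rightarrow> enat"
  assumes alpha: "\<forall>i\<in>{1, 2}. \<forall>n\<ge>1. 0 < \<alpha> i n \<and> \<alpha> i n < 1"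
    and q: "comb_probabilities \<alpha> q"
    and smc: "stationary_markov_chain P letter_memory_space (letter_memory_kernel \<alpha>)
        (\<lambda>n \<omega>. (X n \<omega>, M n \<omega>))"
  shows "stationary_vlmc P double_comb q (word_process X)"
proof -
  let ?S = letter_memory_space and ?K = "letter_memory_kernel \<alpha>" and ?W = "word_process X"
  let ?V = "vlmc_kernel double_comb q"
  define Z where "Z n \<omega> = (X n \<omega>, M n \<omega>)" for n \<omega>
  have P: "prob_space P" and Z: "\<And>n. Z n \<in> measurable P ?S"
    and at: "\<And>n. markov_at P ?S ?K Z n" and st: "stationary_process P ?S Z"
    using smc unfolding Z_def[abs_def] stationary_markov_chain_def
      markov_chain_iff_markov_at[OF measurable_kernel_letter_memory]
    by blast+
  interpret prob_space P by fact
  have run: "AE \<omega> in P. \<forall>n. Z n \<omega> = run_state (\<lambda>k. X (n - int k) \<omega>)"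
    using memory_eq_run_length_AE smc unfolding stationary_markov_chain_def Z_def by blast
  have Wf: "?W k \<in> measurable F left_word_space"
    if "\<And>k. k \<le> int n \<Longrightarrow> Z k \<in> measurable F ?S" "k \<le> n" for F k n
  proof (rule measurable_left_wordI)
    fix j
    have fst: "fst \<in> measurable ?S (count_space UNIV)"
      by (simp add: letter_memory_space_def)
    have "(\<lambda>\<omega>. fst (Z (int k - int j) \<omega>)) \<in> measurable F (count_space UNIV)"
      using that by (intro measurable_compose[OF _ fst]) simp
    then show "(\<lambda>\<omega>. ?W k \<omega> j) \<in> measurable F (count_space UNIV)"
      by (simp add: word_process_def Z_def)
  qed
  have W: "?W k \<in> measurable P left_word_space" for k
    by (rule Wf[of k]) (use Z in auto)
  have "markov_at P left_word_space ?V ?W n" for n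
    unfolding markov_at_def
  proof (intro ballI)
    fix A B assume A[measurable]: "A \<in> sets left_word_space"
      and B: "B \<in> sets (past_algebra P left_word_space ?W n)"
    let ?F = "past_algebra P ?S Z (int n)"
    have ZF: "Z k \<in> measurable ?F ?S" if "k \<le> int n" for k
      using that measurable_space[OF Z] by (intro measurable_past_algebra) auto
    have F: "sets ?F \<subseteq> sets P"
      by (rule past_algebra_subset_sets) (use Z in auto)
    have "sets (past_algebra P left_word_space ?W n) \<subseteq> sets ?F"
      by (rule past_algebra_subset_sets) (use Wf ZF in auto)
    then have BF: "B \<in> sets ?F" using B by auto
    have Wn: "?W n \<in> measurable ?F left_word_space"
      by (rule Wf[of n]) (use ZF in auto)
    \<comment> \<open>The part of the event that is already decided at time \<open>n\<close>, if the next letter is \<open>l\<close>.\<close>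
    define B' where "B' l = B \<inter> {\<omega> \<in> space P. append_letter (?W n \<omega>) l \<in> A}" for l
    have B'F: "B' l \<in> sets ?F" for l
    proof -
      have "(\<lambda>\<omega>. append_letter (?W n \<omega>) l) -` A \<inter> space ?F \<in> sets ?F"
        by (rule measurable_sets[OF measurable_compose[OF Wn measurable_append_letter] A])
      moreover have "(\<lambda>\<omega>. append_letter (?W n \<omega>) l) -` A \<inter> space ?F =
          {\<omega> \<in> space P. append_letter (?W n \<omega>) l \<in> A}"
        by auto
      ultimately show ?thesis using BF unfolding B'_def by auto
    qed
    have B'P: "B' l \<in> sets P" for l using B'F F by auto
    let ?C = "\<lambda>l. {\<omega> \<in> space P. Z (int n + 1) \<omega> \<in> {l} \<times> {1..}}"
    have CS: "{l} \<times> {1..} \<in> sets ?S" for l by (auto simp: letter_memory_space_def)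
    have CP: "?C l \<in> sets P" for l
      using measurable_sets[OF Z[of "int n + 1"] CS[of l]] by (simp add: vimage_def Int_def conj_commute)
    have lawP: "(\<lambda>\<omega>. pmf (letter_law \<alpha> (Z n \<omega>)) l) \<in> borel_measurable P" for n l
      by (rule measurable_compose[OF Z]) (simp add: letter_memory_space_def)
    have "{\<omega> \<in> space P. ?W (n + 1) \<omega> \<in> A} \<inter> B = (\<Union>l\<in>UNIV. ?C l \<inter> B' l)"
    proof -
      have "\<omega> \<in> ?C (X (int n + 1) \<omega>)" if "\<omega> \<in> space P" for \<omega>
        using measurable_space[OF Z that, of "int n + 1"] that by (simp add: Z_def)
      then show ?thesis
        unfolding word_process_Suc B'_def by (auto simp: Z_def)
    qed
    then have "measure P ({\<omega> \<in> space P. ?W (n + 1) \<omega> \<in> A} \<inter> B) =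
        measure P (\<Union>l\<in>UNIV. ?C l \<inter> B' l)" by simp
    also have "\<dots> = (\<Sum>l\<in>UNIV. measure P (?C l \<inter> B' l))"
      by (rule finite_measure_finite_Union) (use CP B'P in \<open>auto simp: disjoint_family_on_def\<close>)
    also have "\<dots> = (\<Sum>l\<in>UNIV. \<integral>\<omega>. indicat_real (B' l) \<omega> * pmf (letter_law \<alpha> (Z (int n) \<omega>)) l \<partial>P)"
      using at[of "int n"] B'F CS
      unfolding markov_at_def prob_letter_memory_kernel_letter[symmetric] by simp
    also have "\<dots> = (\<integral>\<omega>. (\<Sum>l\<in>UNIV. indicat_real (B' l) \<omega> * pmf (letter_law \<alpha> (Z (int n) \<omega>)) l) \<partial>P)"
    proof (rule Bochner_Integration.integral_sum[symmetric])
      fix l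
      show "integrable P (\<lambda>\<omega>. indicat_real (B' l) \<omega> * pmf (letter_law \<alpha> (Z (int n) \<omega>)) l)"
        using B'P lawP by (intro integrable_const_bound[where B=1] borel_measurable_times)
          (auto simp: indicator_def pmf_le_1)
    qed
    also have "\<dots> = (\<integral>\<omega>. indicat_real B \<omega> * measure_pmf.prob (?V (?W n \<omega>)) A \<partial>P)"
    proof (rule integral_cong_AE)
      have kernel: "(\<lambda>\<omega>. measure_pmf.prob (?V (?W n \<omega>)) A) \<in> borel_measurable P"
        using measurable_compose[OF W] A measurable_kernel_vlmc_double_comb[OF alpha q]
        unfolding measurable_kernel_def by blast
      show "(\<lambda>\<omega>. indicat_real B \<omega> * measure_pmf.prob (?V (?W n \<omega>)) A) \<in> borel_measurable P"
        using BF F kernel by (intro borel_measurable_times) auto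
      show "(\<lambda>\<omega>. \<Sum>l\<in>UNIV. indicat_real (B' l) \<omega> * pmf (letter_law \<alpha> (Z (int n) \<omega>)) l)
          \<in> borel_measurable P"
        using B'P lawP by (intro borel_measurable_sum borel_measurable_times) auto
      show "AE \<omega> in P. (\<Sum>l\<in>UNIV. indicat_real (B' l) \<omega> * pmf (letter_law \<alpha> (Z (int n) \<omega>)) l) =
          indicat_real B \<omega> * measure_pmf.prob (?V (?W n \<omega>)) A"
        using run AE_space
      proof eventually_elim
        case (elim \<omega>)
        then have "run_state (?W n \<omega>) = Z (int n) \<omega>" by (simp add: word_process_def[abs_def])
        then show ?case
          using elim(2) unfolding vlmc_kernel_double_comb[OF alpha q] prob_map_bool_pmf B'_def
          by (auto simp: indicator_def sum_distrib_left intro!: sum.cong)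
      qed
    qed
    finally show "measure P ({\<omega> \<in> space P. ?W (n + 1) \<omega> \<in> A} \<inter> B) =
        (\<integral>\<omega>. indicat_real B \<omega> * measure_pmf.prob (?V (?W n \<omega>)) A \<partial>P)" .
  qed
  moreover have "stationary_process P left_word_space ?W"
  proof -
    let ?\<Phi> = "\<lambda>(z :: int \<Rightarrow> bool \<times> enat) (n::nat) (k::nat). fst (z (int n - int k))"
    let ?Z = "PiM UNIV (\<lambda>_::int. ?S)" and ?L = "PiM UNIV (\<lambda>_::nat. left_word_space)"
    have \<Phi>: "?\<Phi> \<in> measurable ?Z ?L"
    proof (rule measurable_path, rule measurable_left_wordI)
      fix n k :: nat
      show "(\<lambda>z. fst (z (int n - int k))) \<in> measurable ?Z (count_space UNIV)"
        by (rule measurable_compose[OF measurable_component_singleton])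
          (simp_all add: letter_memory_space_def)
    qed
    have path: "(\<lambda>\<omega> n. Z (n + i) \<omega>) \<in> measurable P ?Z" for i
      by (rule measurable_path) (rule Z)
    have "distr (distr P ?Z (\<lambda>\<omega> n. Z (n + int i) \<omega>)) ?L ?\<Phi> =
        distr P ?L (\<lambda>\<omega> n. ?W (n + i) \<omega>)" for i
      unfolding distr_distr[OF \<Phi> path] by (simp add: comp_def Z_def word_process_def[abs_def] algebra_simps)
    from this[of 1] this[of 0] st show ?thesis
      by (simp add: stationary_process_def)
  qed
  ultimately show ?thesis
    using P W unfolding stationary_vlmc_def stationary_markov_chain_def
      markov_chain_iff_markov_at[OF measurable_kernel_vlmc_double_comb[OF alpha q]] by blast
qed

section \<open>From the words to the letter/memory chain\<close>

text \<open>
  If \<open>U\<close> grows by appending letters, then all its words are the pasts of a single two-sided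
  sequence of letters.
\<close>

lemma letter_eq_of_append:
  assumes step: "\<And>n k. U (n + 1) \<omega> (Suc k) = U n \<omega> k"
  shows "letter U (int n - int k) \<omega> = U n \<omega> k"
proof -
  have shift: "U (n + m) \<omega> (k + m) = U n \<omega> k" for n m k
  proof (induction m)
    case (Suc m)
    then show ?case using step[of "n + m" "k + m"] by simp
  qed simp
  show ?thesis
  proof (cases "k \<le> n")
    case True
    then show ?thesis
      using shift[of "n - k" k 0] by (simp add: letter_def nat_diff_distrib)
  next
    case False
    then show ?thesis
      using shift[of 0 n "k - n"] by (simp add: letter_def nat_diff_distrib)
  qed
qed

text \<open>
  A VLMC is only required to have the right conditional laws, so its words extend one another
  almost surely rather than everywhere.
\<close>

lemma vlmc_letter_eq:
  assumes mc: "markov_chain Q left_word_space (vlmc_kernel C q) U"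
    and K: "measurable_kernel left_word_space (vlmc_kernel C q)"
  shows "AE \<omega> in Q. \<forall>n k. letter U (int n - int k) \<omega> = U n \<omega> k"
proof -
  have Q: "prob_space Q" and U: "\<And>n. U n \<in> measurable Q left_word_space"
    and at: "\<And>n. markov_at Q left_word_space (vlmc_kernel C q) U n"
    using mc unfolding markov_chain_iff_markov_at[OF K] by blast+
  have "AE \<omega> in Q. U n \<omega> \<in> {u. u k = b} \<longrightarrow> U (n + 1) \<omega> \<notin> {u. u (Suc k) \<noteq> b}" for n k b
  proof (rule markov_at_AE_avoid[OF Q U at])
    have "{u \<in> space left_word_space. u k = b} \<in> sets left_word_space"
      "{u \<in> space left_word_space. u (Suc k) \<noteq> b} \<in> sets left_word_space"
      by measurable
    then show "{u. u k = b} \<in> sets left_word_space" "{u. u (Suc k) \<noteq> b} \<in> sets left_word_space"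
      by simp_all
    show "measure_pmf.prob (vlmc_kernel C q u) {u. u (Suc k) \<noteq> b} = 0" if "u \<in> {u. u k = b}" for u
      using that unfolding vlmc_kernel_def prob_map_bool_pmf
      by (auto simp: append_letter_def indicator_def)
  qed
  then have "AE \<omega> in Q. \<forall>n k b. U n \<omega> \<in> {u. u k = b} \<longrightarrow> U (n + 1) \<omega> \<notin> {u. u (Suc k) \<noteq> b}"
    by (simp only: AE_all_countable) blast
  then show ?thesis
  proof eventually_elim
    case (elim \<omega>)
    show ?case
      by (intro allI letter_eq_of_append) (use elim in auto)
  qed
qed

lemma measurable_letter:
  assumes U: "\<And>n. U n \<in> measurable Q left_word_space"
  shows "letter U n \<in> measurable Q (count_space UNIV)"
proof -
  have [measurable]: "(\<lambda>\<omega>. U m \<omega> k) \<in> measurable Q (count_space UNIV)" for m k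
    by (rule measurable_compose[OF U measurable_left_word_component])
  show ?thesis
    unfolding letter_def[abs_def] by (cases "n \<ge> 0") simp_all
qed

text \<open>
  Finitely many letters at times \<open>\<ge> - m\<close> are all visible at depth \<open>m\<close>: the letter at
  time \<open>j\<close> has position \<open>m\<close> in the word at time \<open>j + m \<ge> 0\<close>. Thus every finite-dimensional
  law of the two-sided letter sequence is a law of the one-sided process \<open>U\<close>, and inherits its
  stationarity.
\<close>

lemma stationary_letters:
  assumes Q: "prob_space Q" and U: "\<And>n. U n \<in> measurable Q left_word_space"
    and st: "stationary_process Q left_word_space U"
    and letter: "AE \<omega> in Q. \<forall>n k. letter U (int n - int k) \<omega> = U n \<omega> k"
  shows "stationary_process Q (count_space UNIV) (letter U)"
  unfolding stationary_process_def
proof (rule measure_eqI_PiM_infinite)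
  interpret prob_space Q by fact
  let ?\<Pi> = "PiM UNIV (\<lambda>_::int. count_space (UNIV :: bool set))"
  let ?L = "PiM UNIV (\<lambda>_::nat. left_word_space)"
  have L: "(\<lambda>\<omega> n. letter U (n + i) \<omega>) \<in> measurable Q ?\<Pi>" for i
    by (rule measurable_path) (rule measurable_letter[OF U])
  show "finite_measure (distr Q ?\<Pi> (\<lambda>\<omega> n. letter U (n + 1) \<omega>))"
    using prob_space.finite_measure[OF prob_space_distr[OF L[of 1]]] .
  fix A :: "int \<Rightarrow> bool set" and J :: "int set"
  assume J: "finite J"
  let ?E = "prod_emb UNIV (\<lambda>_. count_space UNIV) J (Pi\<^sub>E J A) :: (int \<Rightarrow> bool) set"
  \<comment> \<open>A depth at which all letters at times in \<open>J\<close> are visible.\<close>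
  define m where "m = (\<Sum>j\<in>J. nat \<bar>j\<bar>)"
  have m: "0 \<le> j + int m" if "j \<in> J" for j
  proof -
    have "nat \<bar>j\<bar> \<le> m" unfolding m_def using J that by (intro member_le_sum) auto
    then show ?thesis by linarith
  qed
  define D where "D = {y. \<forall>j\<in>J. y (nat (j + int m)) m \<in> A j}"
  have D: "D \<in> sets ?L"
  proof -
    have [measurable]: "(\<lambda>y. y n k) \<in> measurable ?L (count_space UNIV)" for n k
      by (rule measurable_compose[OF _ measurable_left_word_component])
        (rule measurable_component_singleton, simp)
    have "{y \<in> space ?L. \<forall>j\<in>J. y (nat (j + int m)) m \<in> A j} \<in> sets ?L"
      using J by measurable
    then show ?thesis by (simp add: D_def space_PiM)
  qed
  have E: "?E \<in> sets ?\<Pi>"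
    using J by (intro sets_PiM_I) auto
  have Um: "(\<lambda>\<omega> n. U (n + i) \<omega>) \<in> measurable Q ?L" for i
    by (rule measurable_path) (rule U)
  have eq: "emeasure (distr Q ?\<Pi> (\<lambda>\<omega> n. letter U (n + int i) \<omega>)) ?E =
      emeasure (distr Q ?L (\<lambda>\<omega> n. U (n + i) \<omega>)) D" for i
  proof -
    have "emeasure (distr Q ?\<Pi> (\<lambda>\<omega> n. letter U (n + int i) \<omega>)) ?E =
        emeasure Q ((\<lambda>\<omega> n. letter U (n + int i) \<omega>) -` ?E \<inter> space Q)"
      by (rule emeasure_distr[OF L E])
    also have "\<dots> = emeasure Q ((\<lambda>\<omega> n. U (n + i) \<omega>) -` D \<inter> space Q)"
    proof (rule emeasure_eq_AE)
      show "AE \<omega> in Q. \<omega> \<in> (\<lambda>\<omega> n. letter U (n + int i) \<omega>) -` ?E \<inter> space Q \<longleftrightarrow>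
          \<omega> \<in> (\<lambda>\<omega> n. U (n + i) \<omega>) -` D \<inter> space Q"
        using letter
      proof eventually_elim
        case (elim \<omega>)
        have "letter U (j + int i) \<omega> = U (nat (j + int m) + i) \<omega> m" if "j \<in> J" for j
        proof -
          have "j + int i = int (nat (j + int m) + i) - int m" using m[OF that] by simp
          then show ?thesis using elim by metis
        qed
        then show ?case
          by (auto simp: D_def prod_emb_def PiE_iff)
      qed
    qed (use measurable_sets[OF L E] measurable_sets[OF Um D] in auto)
    also have "\<dots> = emeasure (distr Q ?L (\<lambda>\<omega> n. U (n + i) \<omega>)) D"
      by (rule emeasure_distr[OF Um D, symmetric])
    finally show ?thesis .
  qed
  from eq[of 1] eq[of 0] st
  show "emeasure (distr Q ?\<Pi> (\<lambda>\<omega> n. letter U (n + 1) \<omega>)) ?E =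
      emeasure (distr Q ?\<Pi> (\<lambda>\<omega> n. letter U n \<omega>)) ?E"
    by (simp add: stationary_process_def)
qed simp_all

text \<open>
  The initial word already contains all letters at negative times, so the chain can be written
  down on the two-sided time set on the same probability space. By stationarity, its Markov
  property is needed at time \<open>0\<close> only, where the past is contained in the \<open>\<sigma>\<close>-algebra
  generated by the initial word and the Markov property of the VLMC projects.
\<close>

lemma stationary_letter_memory_chain:
  assumes alpha: "\<forall>i\<in>{1, 2}. \<forall>n\<ge>1. 0 < \<alpha> i n \<and> \<alpha> i n < 1"
    and q: "comb_probabilities \<alpha> q"
    and vlmc: "stationary_vlmc Q double_comb q U"
  shows "stationary_markov_chain Q letter_memory_space (letter_memory_kernel \<alpha>)
    (\<lambda>n \<omega>. run_state (\<lambda>k. letter U (n - int k) \<omega>))"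
proof -
  let ?V = "vlmc_kernel double_comb q" and ?S = letter_memory_space and ?K = "letter_memory_kernel \<alpha>"
  define Z where "Z n \<omega> = run_state (\<lambda>k. letter U (n - int k) \<omega>)" for n \<omega>
  note V = measurable_kernel_vlmc_double_comb[OF alpha q]
  have mc: "markov_chain Q left_word_space ?V U" and stU: "stationary_process Q left_word_space U"
    using vlmc unfolding stationary_vlmc_def stationary_markov_chain_def by blast+
  then have Q: "prob_space Q" and U: "\<And>n. U n \<in> measurable Q left_word_space"
    and at: "\<And>n. markov_at Q left_word_space ?V U n"
    unfolding markov_chain_iff_markov_at[OF V] by blast+
  note letter = vlmc_letter_eq[OF mc V]
  have Z: "Z n \<in> measurable Q ?S" for n
    unfolding Z_def[abs_def]
    by (intro measurable_compose[OF measurable_left_wordI measurable_run_state] measurable_letter U)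
  have stZ: "stationary_process Q ?S Z"
  proof -
    let ?L = "PiM UNIV (\<lambda>_::int. count_space (UNIV :: bool set))"
    let ?\<Psi> = "\<lambda>(x :: int \<Rightarrow> bool) n. run_state (\<lambda>k. x (n - int k))"
    have \<Psi>: "?\<Psi> \<in> measurable ?L (PiM UNIV (\<lambda>_. ?S))"
      by (intro measurable_path measurable_compose[OF measurable_left_wordI measurable_run_state]
          measurable_component_singleton) simp
    have path: "(\<lambda>\<omega> n. letter U (n + i) \<omega>) \<in> measurable Q ?L" for i
      by (rule measurable_path) (rule measurable_letter[OF U])
    have "distr (distr Q ?L (\<lambda>\<omega> n. letter U (n + i) \<omega>)) (PiM UNIV (\<lambda>_. ?S)) ?\<Psi> =
        distr Q (PiM UNIV (\<lambda>_. ?S)) (\<lambda>\<omega> n. Z (n + i) \<omega>)" for i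
      unfolding distr_distr[OF \<Psi> path] by (simp add: comp_def Z_def algebra_simps)
    from this[of 1] this[of 0] stationary_letters[OF Q U stU letter] show ?thesis
      by (simp add: stationary_process_def)
  qed
  \<comment> \<open>At times \<open>k \<le> 0\<close> the word is the initial word without its last \<open>- k\<close> letters, for every \<open>\<omega>\<close>.\<close>
  have Z0: "Z k \<omega> = run_state (\<lambda>j. U 0 \<omega> (nat (- k) + j))" if "k \<le> 0" for k \<omega>
  proof -
    have "letter U (k - int j) \<omega> = U 0 \<omega> (nat (- k) + j)" for j
      using that by (cases "k - int j = 0") (auto simp: letter_def nat_diff_distrib nat_add_distrib
          intro!: arg_cong[where f = "U 0 \<omega>"])
    then show ?thesis by (simp add: Z_def)
  qed
  have "markov_at Q ?S ?K Z 0"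
    unfolding markov_at_def
  proof (intro ballI)
    fix A B assume A: "A \<in> sets ?S" and B: "B \<in> sets (past_algebra Q ?S Z 0)"
    let ?F = "past_algebra Q left_word_space U 0"
    have F: "sets ?F \<subseteq> sets Q"
      by (rule past_algebra_subset_sets) (use U in auto)
    have U0: "U 0 \<in> measurable ?F left_word_space"
      by (rule measurable_past_algebra) auto
    have "sets (past_algebra Q ?S Z 0) \<subseteq> sets ?F"
    proof (rule past_algebra_subset_sets)
      fix k :: int assume "k \<le> 0"
      then have "Z k = (\<lambda>\<omega>. run_state (\<lambda>j. U 0 \<omega> (nat (- k) + j)))"
        using Z0 by auto
      also have "\<dots> \<in> measurable ?F ?S"
        by (intro measurable_compose[OF measurable_left_wordI measurable_run_state]
            measurable_compose[OF U0 measurable_left_word_component])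
      finally show "Z k \<in> measurable ?F ?S" .
    qed simp
    with B have BF: "B \<in> sets ?F" by auto
    let ?A = "run_state -` A"
    have A': "?A \<in> sets left_word_space"
      using measurable_sets[OF measurable_run_state A] by simp
    have BQ: "B \<in> sets Q" using BF F by auto
    have ZA: "{\<omega> \<in> space Q. Z (0 + 1) \<omega> \<in> A} \<in> sets Q"
      using measurable_sets[OF Z[of "0 + 1"] A] by (simp add: vimage_def Int_def conj_commute)
    have UA: "{\<omega> \<in> space Q. U (0 + 1) \<omega> \<in> ?A} \<in> sets Q"
      using measurable_sets[OF U[of "0 + 1"] A'] by (simp add: vimage_def Int_def conj_commute)
    have "measure Q ({\<omega> \<in> space Q. Z (0 + 1) \<omega> \<in> A} \<inter> B) =
        measure Q ({\<omega> \<in> space Q. U (0 + 1) \<omega> \<in> ?A} \<inter> B)"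
    proof (rule measure_eq_AE)
      show "AE \<omega> in Q. \<omega> \<in> {\<omega> \<in> space Q. Z (0 + 1) \<omega> \<in> A} \<inter> B \<longleftrightarrow>
          \<omega> \<in> {\<omega> \<in> space Q. U (0 + 1) \<omega> \<in> ?A} \<inter> B"
        using letter
      proof eventually_elim
        case (elim \<omega>)
        have "letter U (1 - int k) \<omega> = U 1 \<omega> k" for k
          using elim[rule_format, of 1 k] by simp
        then have "Z 1 \<omega> = run_state (U 1 \<omega>)" by (simp add: Z_def)
        then show ?case by simp
      qed
    qed (use ZA UA BQ in auto)
    also have "\<dots> = (\<integral>\<omega>. indicat_real B \<omega> * measure_pmf.prob (?V (U 0 \<omega>)) ?A \<partial>Q)"
      using at[of 0] A' BF unfolding markov_at_def by blast
    also have "\<dots> = (\<integral>\<omega>. indicat_real B \<omega> * measure_pmf.prob (?K (Z 0 \<omega>)) A \<partial>Q)"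
      using Z0[of 0] by (simp add: map_run_state_vlmc_kernel[OF alpha q, symmetric])
    finally show "measure Q ({\<omega> \<in> space Q. Z (0 + 1) \<omega> \<in> A} \<inter> B) =
        (\<integral>\<omega>. indicat_real B \<omega> * measure_pmf.prob (?K (Z 0 \<omega>)) A \<partial>Q)" .
  qed
  then have "markov_at Q ?S ?K Z n" for n
    by (rule markov_at_all_times[OF measurable_kernel_letter_memory Z stZ])
  then show ?thesis
    using Q Z stZ unfolding stationary_markov_chain_def Z_def[abs_def]
      markov_chain_iff_markov_at[OF measurable_kernel_letter_memory] by blast
qed

section \<open>The correspondence\<close>

theorem theorem3p3:
  fixes \<alpha> :: "nat \<Rightarrow> enat \<Rightarrow> real"
    and P :: "'w measure" and X :: "int \<Rightarrow> 'w \<Rightarrow> bool" and M :: "int \<Rightarrow> 'w \<Rightarrow> enat"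
    and Q :: "'v measure" and U :: "nat \<Rightarrow> 'v \<Rightarrow> left_word" and q :: "ctxt \<Rightarrow> bool pmf"
  assumes alpha: "\<And>i n. i \<in> {1, 2} \<Longrightarrow> n \<ge> 1 \<Longrightarrow> 0 < \<alpha> i n \<and> \<alpha> i n < 1"
  shows
    "(stationary_markov_chain P letter_memory_space (letter_memory_kernel \<alpha>)
        (\<lambda>n \<omega>. (X n \<omega>, M n \<omega>)) \<and>
      Theta \<alpha> 1 < \<infinity> \<and> Theta \<alpha> 2 < \<infinity>
      \<longrightarrow> (\<exists>p. comb_probabilities \<alpha> p \<and>
               stationary_vlmc P double_comb p (word_process X)))
     \<and>
     (stationary_vlmc Q double_comb q U \<and> comb_probabilities \<alpha> q
      \<longrightarrow> stationary_markov_chain Q letter_memory_space (letter_memory_kernel \<alpha>)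
            (\<lambda>n \<omega>. (letter U (int n) \<omega>, memory U n \<omega>)) \<and>
          (\<exists>N :: (int \<Rightarrow> bool \<times> enat) measure.
             stationary_markov_chain N letter_memory_space (letter_memory_kernel \<alpha>)
               (\<lambda>n \<omega>. \<omega> n) \<and>
             distr N (PiM UNIV (\<lambda>_::nat. letter_memory_space)) (\<lambda>\<omega> n. \<omega> (int n)) =
             distr Q (PiM UNIV (\<lambda>_::nat. letter_memory_space))
               (\<lambda>\<omega> n. (letter U (int n) \<omega>, memory U n \<omega>))))"
proof (intro conjI impI; elim conjE)
  have alpha': "\<forall>i\<in>{1, 2}. \<forall>n\<ge>1. 0 < \<alpha> i n \<and> \<alpha> i n < 1" using alpha by blast
  {
    assume "stationary_markov_chain P letter_memory_space (letter_memory_kernel \<alpha>)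
      (\<lambda>n \<omega>. (X n \<omega>, M n \<omega>))"
    then show "\<exists>p. comb_probabilities \<alpha> p \<and> stationary_vlmc P double_comb p (word_process X)"
      using comb_probabilities_ex[OF alpha'] stationary_vlmc_word_process[OF alpha'] by blast
  }
  let ?S = letter_memory_space and ?K = "letter_memory_kernel \<alpha>"
  let ?Z = "\<lambda>n \<omega>. run_state (\<lambda>k. letter U (n - int k) \<omega>)"
  assume U: "stationary_vlmc Q double_comb q U" and q: "comb_probabilities \<alpha> q"
  have Z: "stationary_markov_chain Q ?S ?K ?Z"
    by (rule stationary_letter_memory_chain[OF alpha' q U])
  have Zn: "?Z (int n) \<omega> = (letter U (int n) \<omega>, memory U n \<omega>)" for n \<omega>
    by (simp add: run_state_def memory_eq_run_length)
  show "stationary_markov_chain Q ?S ?K (\<lambda>n \<omega>. (letter U (int n) \<omega>, memory U n \<omega>))"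
    using stationary_markov_chain_restrict_nat[OF measurable_kernel_letter_memory Z]
    unfolding Zn .
  let ?N = "distr Q (PiM UNIV (\<lambda>_. ?S)) (\<lambda>\<omega> n. ?Z n \<omega>)"
  have "stationary_markov_chain ?N ?S ?K (\<lambda>n \<omega>. \<omega> n)"
    by (rule stationary_markov_chain_canonical[OF measurable_kernel_letter_memory Z])
  moreover have "distr ?N (PiM UNIV (\<lambda>_::nat. ?S)) (\<lambda>\<omega> n. \<omega> (int n)) =
      distr Q (PiM UNIV (\<lambda>_::nat. ?S)) (\<lambda>\<omega> n. (letter U (int n) \<omega>, memory U n \<omega>))"
  proof -
    have "?Z n \<in> measurable Q ?S" for n
      using Z by (simp add: stationary_markov_chain_def markov_chain_def)
    then have "(\<lambda>\<omega> n. ?Z n \<omega>) \<in> measurable Q (PiM UNIV (\<lambda>_. ?S))"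
      by (rule measurable_path)
    moreover have "(\<lambda>\<omega> n. \<omega> (int n)) \<in> measurable (PiM UNIV (\<lambda>_::int. ?S)) (PiM UNIV (\<lambda>_::nat. ?S))"
      by (rule measurable_path) simp
    ultimately show ?thesis
      unfolding Zn[symmetric] by (subst distr_distr) (simp_all add: comp_def)
  qed
  ultimately show "\<exists>N :: (int \<Rightarrow> bool \<times> enat) measure.
      stationary_markov_chain N ?S ?K (\<lambda>n \<omega>. \<omega> n) \<and>
      distr N (PiM UNIV (\<lambda>_::nat. ?S)) (\<lambda>\<omega> n. \<omega> (int n)) =
      distr Q (PiM UNIV (\<lambda>_::nat. ?S)) (\<lambda>\<omega> n. (letter U (int n) \<omega>, memory U n \<omega>))"
    by blast
qed

end
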